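(* Let $a_{11},a_{12},a_{21},a_{22}$ be real-valued coefficients (functions of $(x,y)$) with $a_{11}>0$ and $\Delta := a_{11}a_{22}-\tfrac14(a_{12}+a_{21})^2>0$. For a complex-valued function $\zeta=\zeta(x,y)$ having first-order partial derivatives, the equation $$a_{11}\zeta_x+\Bigl(\tfrac12(a_{12}+a_{21})+i\sqrt{\Delta}\Bigr)\zeta_y=0$$ reads in complex form (i.e. is equivalent to) $$\zeta_{\bar z}-q_\star\,\zeta_z=0,\qquad q_\star=-\,\frac{a_{11}-\sqrt{\Delta}+\tfrac{i}{2}(a_{12}+a_{21})}{a_{11}+\sqrt{\Delta}-\tfrac{i}{2}(a_{12}+a_{21})}.$$ That is, $q_\star=-q$, where $$q=\frac{a_{11}-\sqrt{\Delta}+\tfrac{i}{2}(a_{12}+a_{21})}{a_{11}+\sqrt{\Delta}-\tfrac{i}{2}(a_{12}+a_{21})}.$$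
   Context: Here $z=x+iy$, and $\zeta_z,\zeta_{\bar z}$ are the Wirtinger derivatives $\zeta_z=\tfrac12(\zeta_x-i\zeta_y)$, $\zeta_{\bar z}=\tfrac12(\zeta_x+i\zeta_y)$, equivalently $\zeta_x=\zeta_z+\zeta_{\bar z}$, $\zeta_y=i(\zeta_z-\zeta_{\bar z})$. The coefficient $q$ is the one printed in equation (7.14) of Vekua's "Generalized Analytic Functions" (1962 Pergamon edition). $\sqrt{\Delta}$ denotes the positive square root. *)

theory Defs
  imports "HOL-Analysis.Analysis"
begin

text \<open>
  The \<open>(x,y)\<close>-plane is identified with type \<^typ>\<open>complex\<close> via \<open>z = x + i y\<close>.
  Partial derivatives are derivatives of the restrictions to the horizontal and vertical
  lines through the point; existence of both is weaker than real differentiability.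
\<close>

definition partial_x :: "(complex \<Rightarrow> complex) \<Rightarrow> complex \<Rightarrow> complex" where
  "partial_x f z = vector_derivative (\<lambda>x. f (Complex x (Im z))) (at (Re z))"

definition partial_y :: "(complex \<Rightarrow> complex) \<Rightarrow> complex \<Rightarrow> complex" where
  "partial_y f z = vector_derivative (\<lambda>y. f (Complex (Re z) y)) (at (Im z))"

definition has_partials_at :: "(complex \<Rightarrow> complex) \<Rightarrow> complex \<Rightarrow> bool" where
  "has_partials_at f z \<longleftrightarrow>
     (\<lambda>x. f (Complex x (Im z))) differentiable (at (Re z)) \<and>
     (\<lambda>y. f (Complex (Re z) y)) differentiable (at (Im z))"

definition wirtinger_z :: "(complex \<Rightarrow> complex) \<Rightarrow> complex \<Rightarrow> complex" where
  "wirtinger_z f z = 1/2 * (partial_x f z - \<i> * partial_y f z)"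

definition wirtinger_zbar :: "(complex \<Rightarrow> complex) \<Rightarrow> complex \<Rightarrow> complex" where
  "wirtinger_zbar f z = 1/2 * (partial_x f z + \<i> * partial_y f z)"

definition Delta :: "real \<Rightarrow> real \<Rightarrow> real \<Rightarrow> real \<Rightarrow> real" where
  "Delta a11 a12 a21 a22 = a11 * a22 - 1/4 * (a12 + a21)^2"

text \<open>The coefficient as printed in equation (7.14) of Vekua, Generalized Analytic Functions
  (Pergamon, 1962).\<close>

definition q_vekua :: "real \<Rightarrow> real \<Rightarrow> real \<Rightarrow> real \<Rightarrow> complex" where
  "q_vekua a11 a12 a21 a22 =
     (of_real a11 - of_real (sqrt (Delta a11 a12 a21 a22)) + \<i> / 2 * of_real (a12 + a21)) /
     (of_real a11 + of_real (sqrt (Delta a11 a12 a21 a22)) - \<i> / 2 * of_real (a12 + a21))"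

definition q_star :: "real \<Rightarrow> real \<Rightarrow> real \<Rightarrow> real \<Rightarrow> complex" where
  "q_star a11 a12 a21 a22 =
     - ((of_real a11 - of_real (sqrt (Delta a11 a12 a21 a22)) + \<i> / 2 * of_real (a12 + a21)) /
        (of_real a11 + of_real (sqrt (Delta a11 a12 a21 a22)) - \<i> / 2 * of_real (a12 + a21)))"

end

theory Submission
  imports Defs
begin

text \<open>At each point the claim is linear algebra in the two numbers \<open>p\<close> =
  \<zeta>_x and \<open>r\<close> = \<zeta>_y. Substituting p = w + v and r = \<i> (w - v), with w =
  \<zeta>_z and v = \<zeta>_zbar, turns the left side of the equation into D v + N w, where D and N
  are the denominator and numerator of the printed coefficient. Dividing by D gives v + (N/D) w = 0,
  so the coefficient of \<zeta>_z after the minus sign is -N/D; this is where the sign comes from.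
  \<open>beltrami_form_iff\<close> does this over arbitrary complex numbers with D nonzero;
  positivity of \<open>a11\<close> and of the discriminant supplies D \<noteq> 0.\<close>

lemma beltrami_form_iff:
  fixes a b s p r :: complex
  assumes "a + s - \<i> / 2 * b \<noteq> 0"
  shows "a * p + (1/2 * b + \<i> * s) * r = 0 \<longleftrightarrow>
    1/2 * (p + \<i> * r)
      - (- ((a - s + \<i> / 2 * b) / (a + s - \<i> / 2 * b))) * (1/2 * (p - \<i> * r)) = 0"
proof -
  define D N where "D = a + s - \<i> / 2 * b" and "N = a - s + \<i> / 2 * b"
  have "D \<noteq> 0"
    using assms by (simp add: D_def)
  \<comment> \<open>The product \<i> * (\<i> * s) = -s gives \<open>s\<close> opposite signs in
    \<open>D\<close> and \<open>N\<close>.\<close>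
  have "a * p + (1/2 * b + \<i> * s) * r = D * (1/2 * (p + \<i> * r)) + N * (1/2 * (p - \<i> * r))"
    by (simp add: D_def N_def algebra_simps add_divide_distrib diff_divide_distrib)
  also have "\<dots> = D * (1/2 * (p + \<i> * r) - (- (N / D)) * (1/2 * (p - \<i> * r)))"
    using \<open>D \<noteq> 0\<close> by (simp add: distrib_left)
  finally show ?thesis
    unfolding D_def[symmetric] N_def[symmetric] using \<open>D \<noteq> 0\<close> by (metis mult_eq_0_iff)
qed

theorem proposition2:
  fixes G :: "complex set"
    and a11 a12 a21 a22 :: "complex \<Rightarrow> real"
    and \<zeta> :: "complex \<Rightarrow> complex"
  assumes "open G"
    and "\<And>z. z \<in> G \<Longrightarrow> a11 z > 0"
    and "\<And>z. z \<in> G \<Longrightarrow> Delta (a11 z) (a12 z) (a21 z) (a22 z) > 0"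
    and "\<And>z. z \<in> G \<Longrightarrow> has_partials_at \<zeta> z"
  shows "\<forall>z\<in>G.
      of_real (a11 z) + of_real (sqrt (Delta (a11 z) (a12 z) (a21 z) (a22 z)))
        - \<i> / 2 * of_real (a12 z + a21 z) \<noteq> (0 :: complex) \<and>
      (of_real (a11 z) * partial_x \<zeta> z
         + (of_real (1/2 * (a12 z + a21 z))
            + \<i> * of_real (sqrt (Delta (a11 z) (a12 z) (a21 z) (a22 z)))) * partial_y \<zeta> z = 0
       \<longleftrightarrow>
       wirtinger_zbar \<zeta> z - q_star (a11 z) (a12 z) (a21 z) (a22 z) * wirtinger_z \<zeta> z = 0) \<and>
      q_star (a11 z) (a12 z) (a21 z) (a22 z) = - q_vekua (a11 z) (a12 z) (a21 z) (a22 z)"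
proof (intro ballI conjI)
  fix z assume "z \<in> G"
  define s where "s = sqrt (Delta (a11 z) (a12 z) (a21 z) (a22 z))"
  have "a11 z > 0" "s > 0"
    using assms(2,3)[OF \<open>z \<in> G\<close>] by (auto simp: s_def)
  \<comment> \<open>The coefficients are real, so the last term is purely imaginary and the real
    part is \<open>a11 z + s\<close>, a sum of two positive numbers.\<close>
  then have "Re (of_real (a11 z) + of_real s - \<i> / 2 * of_real (a12 z + a21 z)) > 0"
    by simp
  then have D: "of_real (a11 z) + of_real s - \<i> / 2 * of_real (a12 z + a21 z) \<noteq> (0 :: complex)"
    by (metis less_irrefl zero_complex.sel(1))
  then show "of_real (a11 z) + of_real (sqrt (Delta (a11 z) (a12 z) (a21 z) (a22 z)))
      - \<i> / 2 * of_real (a12 z + a21 z) \<noteq> (0 :: complex)"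
    by (simp add: s_def)
  \<comment> \<open>Moves the factor 1/2 outside the embedding, so that the goal matches the lemma
    with \<open>b\<close> equal to the embedded sum.\<close>
  have half: "of_real (1/2 * (a12 z + a21 z)) = (1/2 * of_real (a12 z + a21 z) :: complex)"
    by simp
  show "of_real (a11 z) * partial_x \<zeta> z
         + (of_real (1/2 * (a12 z + a21 z))
            + \<i> * of_real (sqrt (Delta (a11 z) (a12 z) (a21 z) (a22 z)))) * partial_y \<zeta> z = 0
       \<longleftrightarrow>
       wirtinger_zbar \<zeta> z - q_star (a11 z) (a12 z) (a21 z) (a22 z) * wirtinger_z \<zeta> z = 0"
    unfolding half wirtinger_z_def wirtinger_zbar_def q_star_def s_def[symmetric]
    by (rule beltrami_form_iff[OF D])
  show "q_star (a11 z) (a12 z) (a21 z) (a22 z) = - q_vekua (a11 z) (a12 z) (a21 z) (a22 z)"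
    by (simp add: q_star_def q_vekua_def)
qed

end
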